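(* For every natural number $n\geq 2$, \[ \varphi^2(n)\psi^2(n)+\varphi^2(n)\sigma^2(n)+\sigma^2(n)\psi^2(n)\geq 3n^4+4n^3+2n^2+4n+3. \]
   Context: For a natural number $n$, $\varphi(n)$ is Euler's totient function (the number of positive integers not exceeding $n$ that are coprime to $n$). For $n=p_1^{a_1}\cdots p_k^{a_k}$ (distinct primes $p_i$, $a_i\geq1$), the Dedekind function is $\psi(n)=\prod_{i=1}^k p_i^{a_i-1}(p_i+1)$, with $\psi(1)=1$. $\sigma(n)$ denotes the sum of the positive divisors of $n$. *)

theory Defs
  imports "HOL-Number_Theory.Totient"
begin

text \<open>
  The natural subtraction in the exponent does not truncate, since every prime factor of
  \<open>n\<close> has multiplicity at least \<open>1\<close>. The empty product gives the value \<open>1\<close> at \<open>n = 1\<close>.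
\<close>
definition dedekind_psi :: "nat \<Rightarrow> nat" where
  "dedekind_psi n = (\<Prod>p\<in>prime_factors n. p ^ (multiplicity p n - 1) * (p + 1))"

definition divisor_sigma :: "nat \<Rightarrow> nat" where
  "divisor_sigma n = (\<Sum>d | d dvd n. d)"

end

theory Submission
  imports Defs
begin

text \<open>
  Since \<open>\<sigma>(n) \<ge> \<psi>(n)\<close>, the left-hand side is at least \<open>2 (\<phi>\<psi>)\<^sup>2 + \<psi>\<^sup>4\<close>, which equals
  \<open>n\<^sup>4 F\<close> with \<open>F = 2 \<Prod>(1 - 1/p\<^sup>2)\<^sup>2 + \<Prod>(1 + 1/p)\<^sup>4\<close>, the products ranging over the primes
  dividing \<open>n\<close>. The first product is at most \<open>1\<close> and the second at least \<open>1\<close>, so adding a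
  prime \<open>p\<close> increases \<open>F\<close> by at least \<open>4x + 2x\<^sup>2 + 4x\<^sup>3 + 3x\<^sup>4\<close> with \<open>x = 1/p\<close>. As \<open>F = 3\<close> for
  the empty product, it suffices to use one prime divisor \<open>p \<le> n\<close>.
\<close>

text \<open>Each factor \<open>p ^ (a - 1) * (p + 1)\<close> is \<open>p ^ a * (1 + 1 / p)\<close>,
  and the prime powers multiply to \<open>n\<close>. This form matches the Euler product of the
  totient.\<close>

lemma dedekind_psi_conv_prod:
  assumes "n > 0"
  shows "real (dedekind_psi n) = real n * (\<Prod>p\<in>prime_factors n. 1 + 1 / real p)"
proof -
  have "real (p ^ (multiplicity p n - 1) * (p + 1)) = real (p ^ multiplicity p n) * (1 + 1 / real p)"
    if "p \<in> prime_factors n" for p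
  proof -
    have "multiplicity p n > 0" "p > 0"
      using that by (auto simp: prime_factors_multiplicity intro: prime_gt_0_nat)
    then show ?thesis
      by (cases "multiplicity p n") (simp_all add: field_simps)
  qed
  then have "real (dedekind_psi n) =
      (\<Prod>p\<in>prime_factors n. real (p ^ multiplicity p n)) * (\<Prod>p\<in>prime_factors n. 1 + 1 / real p)"
    by (simp add: dedekind_psi_def prod.distrib [symmetric] del: of_nat_power of_nat_mult of_nat_add)
  also have "(\<Prod>p\<in>prime_factors n. real (p ^ multiplicity p n)) = real n"
    using prime_factorization_nat [of n] assms by (metis of_nat_prod)
  finally show ?thesis .
qed

text \<open>
  Expanding the product for \<open>\<psi>(n)\<close> gives the sum of \<open>n/d\<close> over the squarefree divisors \<open>d\<close> only.
\<close>
lemma dedekind_psi_le_divisor_sigma: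
  assumes "n > 0"
  shows "dedekind_psi n \<le> divisor_sigma n"
proof -
  define A where "A = prime_factors n"
  have A: "finite A" "\<And>p. p \<in> A \<Longrightarrow> prime p"
    by (auto simp: A_def)
  have dvd: "\<Prod>B dvd n" if "B \<in> Pow A" for B
  proof -
    have "\<Prod>B dvd \<Prod>A"
      using that A by (intro prod_dvd_prod_subset) auto
    also have "\<Prod>A dvd (\<Prod>p\<in>A. p ^ multiplicity p n)"
      by (intro prod_dvd_prod) (auto simp: A_def prime_factors_multiplicity)
    also have "\<dots> = n"
      using prime_factorization_nat [of n] assms by (simp add: A_def)
    finally show ?thesis .
  qed
  have recover: "prime_factors (\<Prod>B) = B" if "B \<in> Pow A" for B
  proof -
    have "finite B" "\<And>p. p \<in> B \<Longrightarrow> prime p"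
      using that A by (auto intro: finite_subset)
    then show ?thesis
      by (subst prime_factors_prod) (auto simp: prime_factorization_prime dest: prime_gt_0_nat)
  qed
  \<comment> \<open>By unique factorization distinct sets of primes have distinct products, so no
    divisor is counted twice in the sum below.\<close>
  have inj: "inj_on (\<lambda>B. n div \<Prod>B) (Pow A)"
  proof (rule inj_onI)
    fix B C assume BC: "B \<in> Pow A" "C \<in> Pow A" "n div \<Prod>B = n div \<Prod>C"
    then have "\<Prod>B = \<Prod>C"
      using dvd assms by (metis dvd_div_eq_0_iff dvd_mult_div_cancel mult_right_cancel not_gr_zero)
    then show "B = C"
      using recover BC by metis
  qed
  have "real (dedekind_psi n) = (\<Sum>B\<in>Pow A. real n * (\<Prod>p\<in>B. 1 / real p))"
    using assms prod_add [OF A(1), of "\<lambda>p. 1 / real p" "\<lambda>_. 1"]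
    by (simp add: dedekind_psi_conv_prod sum_distrib_left add.commute flip: A_def)
  also have "\<dots> = (\<Sum>B\<in>Pow A. real (n div \<Prod>B))"
    by (intro sum.cong refl) (simp add: prod_dividef real_of_nat_div dvd)
  also have "\<dots> = real (\<Sum>((\<lambda>B. n div \<Prod>B) ` Pow A))"
    by (simp add: sum.reindex [OF inj])
  also have "\<dots> \<le> real (divisor_sigma n)"
    unfolding divisor_sigma_def of_nat_le_iff using assms dvd
    by (intro sum_mono2) (auto, metis dvd_div_mult_self dvd_triv_left)
  finally show ?thesis
    by simp
qed

text \<open>The square term drops by \<open>2 * P^2 * (2 * x^2 - x^4)\<close>, at most
  \<open>4 * x^2 - 2 * x^4\<close> since \<open>P \<le> 1\<close>. The fourth power grows by
  \<open>Q^4 * ((1 + x)^4 - 1)\<close>, at least \<open>4 * x + 6 * x^2 + 4 * x^3 + x^4\<close>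
  since \<open>1 \<le> Q\<close>. The stated gain is the difference.\<close>

lemma two_square_plus_fourth_power_step:
  fixes P Q x :: real
  assumes "0 \<le> P" "P \<le> 1" "1 \<le> Q" "0 \<le> x" "x \<le> 1"
  shows "2 * P^2 + Q^4 + (4 * x + 2 * x^2 + 4 * x^3 + 3 * x^4)
           \<le> 2 * (P * (1 - x^2))^2 + (Q * (1 + x))^4"
proof -
  \<comment> \<open>Here \<open>x \<le> 1\<close> gives \<open>x^4 \<le> x^2\<close>, so the factor
    \<open>2 * x^2 - x^4\<close> is nonnegative.\<close>
  have "P^2 * (2 * x^2 - x^4) \<le> 2 * x^2 - x^4"
    using assms by (intro mult_left_le_one_le) (auto simp: power_le_one
        intro: order_trans [OF power_decreasing [of 2 4 x]])
  moreover have "4 * x + 6 * x^2 + 4 * x^3 + x^4 \<le> Q^4 * (4 * x + 6 * x^2 + 4 * x^3 + x^4)"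
    using mult_right_mono [of 1 "Q^4" "4 * x + 6 * x^2 + 4 * x^3 + x^4"] assms by simp
  ultimately show ?thesis
    by (simp add: algebra_simps power2_eq_square power4_eq_xxxx power3_eq_cube)
qed

lemma two_prod_plus_prod_insert:
  fixes f :: "'a \<Rightarrow> real"
  assumes "finite A" "a \<notin> A" "\<And>b. b \<in> insert a A \<Longrightarrow> 0 \<le> f b \<and> f b \<le> 1"
  shows "2 * (\<Prod>b\<in>A. 1 - f b ^ 2)^2 + (\<Prod>b\<in>A. 1 + f b)^4
           + (4 * f a + 2 * f a^2 + 4 * f a^3 + 3 * f a^4)
         \<le> 2 * (\<Prod>b\<in>insert a A. 1 - f b ^ 2)^2 + (\<Prod>b\<in>insert a A. 1 + f b)^4"
proof -
  have "0 \<le> (\<Prod>b\<in>A. 1 - f b ^ 2)" "(\<Prod>b\<in>A. 1 - f b ^ 2) \<le> 1" "1 \<le> (\<Prod>b\<in>A. 1 + f b)"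
    using assms(3) by (auto intro!: prod_nonneg prod_le_1 prod_ge_1 simp: power_le_one)
  from two_square_plus_fourth_power_step [OF this, of "f a"] show ?thesis
    using assms by (simp add: mult.commute)
qed

text \<open>Empty products give \<open>2 + 1\<close>, and each inserted element adds a nonnegative
  gain.\<close>

lemma two_prod_plus_prod_ge_3:
  fixes f :: "'a \<Rightarrow> real"
  assumes "finite A" "\<And>a. a \<in> A \<Longrightarrow> 0 \<le> f a \<and> f a \<le> 1"
  shows "3 \<le> 2 * (\<Prod>a\<in>A. 1 - f a ^ 2)^2 + (\<Prod>a\<in>A. 1 + f a)^4"
  using assms
proof (induction A rule: finite_induct)
  case (insert a A)
  have "0 \<le> 4 * f a + 2 * f a^2 + 4 * f a^3 + 3 * f a^4"
    using insert.prems by simp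
  moreover have "3 \<le> 2 * (\<Prod>a\<in>A. 1 - f a ^ 2)^2 + (\<Prod>a\<in>A. 1 + f a)^4"
    using insert by simp
  moreover note two_prod_plus_prod_insert [of A a f, OF insert.hyps insert.prems]
  ultimately show ?case
    by linarith
qed simp

theorem theorem3:
  fixes n :: nat
  assumes "n \<ge> 2"
  shows "(totient n)^2 * (dedekind_psi n)^2 + (totient n)^2 * (divisor_sigma n)^2
           + (divisor_sigma n)^2 * (dedekind_psi n)^2
         \<ge> 3 * n^4 + 4 * n^3 + 2 * n^2 + 4 * n + 3"
proof -
  obtain p where p: "prime p" "p dvd n"
    using assms prime_factor_nat [of n] by auto
  define A where "A = prime_factors n"
  \<comment> \<open>With \<open>p\<close> inserted last, its gain is kept in full, while the primes
    in \<open>B\<close> enter only through the bound 3.\<close>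
  define B where "B = A - {p}"
  define x where "x = 1 / real p"
  define P where "P = (\<Prod>q\<in>A. 1 - (1 / real q)^2)"
  define Q where "Q = (\<Prod>q\<in>A. 1 + 1 / real q)"
  have A: "A = insert p B" "p \<notin> B" "finite B"
    using p assms by (auto simp: A_def B_def prime_factors_dvd)
  have range: "0 \<le> 1 / real q \<and> 1 / real q \<le> 1" if "q \<in> A" for q
    using that by (auto simp: A_def dest!: in_prime_factors_imp_prime prime_ge_1_nat)
  have x: "x \<ge> 1 / real n" "x \<le> 1" "n > 0"
    using p assms by (auto simp: x_def field_simps prime_gt_0_nat dvd_imp_le Suc_le_eq)
  \<comment> \<open>The gain is increasing in \<open>x\<close>, and \<open>p \<le> n\<close> means
    \<open>x \<ge> 1 / n\<close>; multiplied by \<open>n^4\<close>, this bound becomes the target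
    polynomial.\<close>
  have "3 + (4 / real n + 2 / real n^2 + 4 / real n^3 + 3 / real n^4)
      \<le> 3 + (4 * x + 2 * x^2 + 4 * x^3 + 3 * x^4)"
  proof -
    have "(1 / real n) ^ k \<le> x ^ k" for k
      using x by (intro power_mono) auto
    from this [of 1] this [of 2] this [of 3] this [of 4] show ?thesis
      by (simp add: power_divide)
  qed
  also have "\<dots> \<le> 2 * P^2 + Q^4"
  proof -
    have "3 \<le> 2 * (\<Prod>q\<in>B. 1 - (1 / real q)^2)^2 + (\<Prod>q\<in>B. 1 + 1 / real q)^4"
      using A(3) range by (intro two_prod_plus_prod_ge_3) (simp_all add: A(1))
    moreover have "2 * (\<Prod>q\<in>B. 1 - (1 / real q)^2)^2 + (\<Prod>q\<in>B. 1 + 1 / real q)^4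
        + (4 * x + 2 * x^2 + 4 * x^3 + 3 * x^4) \<le> 2 * P^2 + Q^4"
      using A(3,2) range unfolding P_def Q_def x_def A(1) by (rule two_prod_plus_prod_insert)
    ultimately show ?thesis
      by linarith
  qed
  finally have "real n^4 * (3 + (4 / real n + 2 / real n^2 + 4 / real n^3 + 3 / real n^4))
      \<le> real n^4 * (2 * P^2 + Q^4)"
    by (intro mult_left_mono) auto
  also have "real n^4 * (3 + (4 / real n + 2 / real n^2 + 4 / real n^3 + 3 / real n^4))
      = real (3 * n^4 + 4 * n^3 + 2 * n^2 + 4 * n + 3)"
    using x(3) by (simp add: field_simps power2_eq_square power3_eq_cube power4_eq_xxxx)
  also have "real n^4 * (2 * P^2 + Q^4)
      = real (2 * (totient n)^2 * (dedekind_psi n)^2 + (dedekind_psi n)^4)"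
  proof -
    have psi: "real (dedekind_psi n) = real n * Q"
      using x(3) by (simp add: dedekind_psi_conv_prod Q_def A_def)
    \<comment> \<open>Factorwise this is \<open>(1 - y) * (1 + y) = 1 - y^2\<close> with
      \<open>y = 1 / q\<close>.\<close>
    have "(\<Prod>q\<in>A. 1 - 1 / real q) * Q = P"
      unfolding P_def Q_def prod.distrib [symmetric]
      by (simp add: algebra_simps power2_eq_square)
    then have "real (totient n) * real (dedekind_psi n) = real n^2 * P"
      using totient_formula2 [of n] by (simp add: psi A_def power2_eq_square mult_ac)
    then have "real (totient n)^2 * real (dedekind_psi n)^2 = (real n^2 * P)^2"
      by (metis power_mult_distrib)
    then show ?thesis
      by (simp add: psi power_mult_distrib algebra_simps flip: power_mult)
  qed
  finally have "3 * n^4 + 4 * n^3 + 2 * n^2 + 4 * n + 3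
      \<le> 2 * (totient n)^2 * (dedekind_psi n)^2 + (dedekind_psi n)^4"
    by (simp only: of_nat_le_iff)
  \<comment> \<open>Split so that \<psi> can be raised to \<sigma> in exactly one factor of each of
    the last two terms.\<close>
  also have "\<dots> = (totient n)^2 * (dedekind_psi n)^2 + (totient n)^2 * (dedekind_psi n)^2
      + (dedekind_psi n)^2 * (dedekind_psi n)^2"
    by (simp flip: power_add)
  also have "\<dots> \<le> (totient n)^2 * (dedekind_psi n)^2 + (totient n)^2 * (divisor_sigma n)^2
           + (divisor_sigma n)^2 * (dedekind_psi n)^2"
    using dedekind_psi_le_divisor_sigma [OF x(3)]
    by (intro add_mono mult_mono power_mono) auto
  finally show ?thesis .
qed

end
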